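(* Let $\mathcal{R}$ be an associative ring with unit $1\neq 0$, let $a,b\in\mathcal{R}$, and let $\mathcal{S},\mathcal{T}$ be right ideals of $\mathcal{R}$ such that $\mathcal{R}=\mathcal{S}\oplus{\rm rann}(a)$ and $\mathcal{R}=a\mathcal{R}\oplus\mathcal{T}$. Let $(\varphi_a)_{|\mathcal{S}}:\mathcal{S}\to a\mathcal{R}$, $s\mapsto as$, be the group isomorphism obtained by restricting $\varphi_a$ from $\mathcal{S}$ to $a\mathcal{R}$. Let $\psi:\mathcal{R}\to\mathcal{R}$ be the group endomorphism given by $\psi(r)=((\varphi_a)_{|\mathcal{S}})^{-1}(\rho_{a\mathcal{R},\mathcal{T}}(r))$ for each $r\in\mathcal{R}$. Then the following assertions are equivalent: (1) $b$ is the unique element in $\mathcal{S}$ such that $ab=\rho_{a\mathcal{R},\mathcal{T}}(1)$. (2) $\psi=\varphi_b$. (3) $b=a^{(1,2)}_{{\rm rprin}=\mathcal{S},{\rm rann}=\mathcal{T}}$, i.e. $aba=a$, $bab=b$, $b\mathcal{R}=\mathcal{S}$ and ${\rm rann}(b)=\mathcal{T}$.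
   Context: Notation: $a\mathcal{R}=\{ar:r\in\mathcal{R}\}$, ${\rm rann}(a)=\{r\in\mathcal{R}:ar=0\}$; $\varphi_a:\mathcal{R}\to\mathcal{R}$ is the additive group endomorphism $\varphi_a(r)=ar$. For additive subgroups $\mathcal{S},\mathcal{T}$ of $\mathcal{R}$, $\mathcal{R}=\mathcal{S}\oplus\mathcal{T}$ means $\mathcal{R}=\mathcal{S}+\mathcal{T}$ and $\mathcal{S}\cap\mathcal{T}=\{0\}$; in that case $\rho_{\mathcal{S},\mathcal{T}}:\mathcal{R}\to\mathcal{R}$ is the group endomorphism $\rho_{\mathcal{S},\mathcal{T}}(s+t)=s$ for $s\in\mathcal{S}$, $t\in\mathcal{T}$. *)

theory Defs
  imports Main "HOL-Library.Set_Algebras"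
begin

definition add_subgroup :: "'a::ring_1 set \<Rightarrow> bool" where
  "add_subgroup S \<longleftrightarrow> 0 \<in> S \<and> (\<forall>x\<in>S. \<forall>y\<in>S. x + y \<in> S) \<and> (\<forall>x\<in>S. - x \<in> S)"

definition right_ideal :: "'a::ring_1 set \<Rightarrow> bool" where
  "right_ideal S \<longleftrightarrow> add_subgroup S \<and> (\<forall>s\<in>S. \<forall>r. s * r \<in> S)"

definition rprin :: "'a::ring_1 \<Rightarrow> 'a set" where
  "rprin a = {a * r | r. True}"

definition rann :: "'a::ring_1 \<Rightarrow> 'a set" where
  "rann a = {r. a * r = 0}"

definition lmult :: "'a::ring_1 \<Rightarrow> 'a \<Rightarrow> 'a" where
  "lmult a = (\<lambda>r. a * r)"

text \<open>Used only for additive subgroups; \<open>S + T\<close> is the elementwise sum of sets.\<close>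

definition direct_sum :: "'a::ring_1 set \<Rightarrow> 'a set \<Rightarrow> bool" where
  "direct_sum S T \<longleftrightarrow> UNIV = S + T \<and> S \<inter> T = {0}"

text \<open>Meaningful only under \<open>direct_sum S T\<close>, with \<open>S\<close> and \<open>T\<close> additive subgroups;
  see \<open>proj_along_eq\<close> below.\<close>

definition proj_along :: "'a::ring_1 set \<Rightarrow> 'a set \<Rightarrow> 'a \<Rightarrow> 'a" where
  "proj_along S T r = (THE s. s \<in> S \<and> (\<exists>t\<in>T. r = s + t))"

text \<open>\<open>inv_into S (lmult a)\<close> is the inverse of the restriction of \<open>lmult a\<close> to a bijection
  from \<open>S\<close> onto \<open>rprin a\<close>; see \<open>bij_betw_lmult\<close> below.\<close>

definition psi :: "'a::ring_1 \<Rightarrow> 'a set \<Rightarrow> 'a set \<Rightarrow> 'a \<Rightarrow> 'a" where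
  "psi a S T = (\<lambda>r. inv_into S (lmult a) (proj_along (rprin a) T r))"

text \<open>\<open>b\<close> is the \<open>{1,2}\<close>-inverse of \<open>a\<close> with principal right ideal \<open>S\<close> and right annihilator
  \<open>T\<close>. There is at most one such \<open>b\<close>; see \<open>inverse12_unique\<close> below.\<close>

definition is_inverse12_rprin_rann :: "'a::ring_1 \<Rightarrow> 'a set \<Rightarrow> 'a set \<Rightarrow> 'a \<Rightarrow> bool" where
  "is_inverse12_rprin_rann a S T b \<longleftrightarrow>
     a * b * a = a \<and> b * a * b = b \<and> rprin b = S \<and> rann b = T"

lemma add_subgroup_rprin: "add_subgroup (rprin a)"
  unfolding add_subgroup_def rprin_def
  by (auto simp: distrib_left[symmetric] intro: exI[of _ 0])
     (metis mult_minus_right)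

lemma add_subgroup_diff: "add_subgroup S \<Longrightarrow> x \<in> S \<Longrightarrow> y \<in> S \<Longrightarrow> x - y \<in> S"
  unfolding add_subgroup_def by (metis diff_conv_add_uminus)

lemma proj_along_eq:
  assumes "add_subgroup S" "add_subgroup T" "direct_sum S T" "s \<in> S" "t \<in> T"
  shows "proj_along S T (s + t) = s"
  unfolding proj_along_def
proof (rule the_equality)
  show "s \<in> S \<and> (\<exists>t'\<in>T. s + t = s + t')" using assms by blast
next
  fix u assume "u \<in> S \<and> (\<exists>t'\<in>T. s + t = u + t')"
  then obtain v where u: "u \<in> S" "v \<in> T" "s + t = u + v" by blast
  have "u - s = t - v" using u(3) by (metis add.commute add_diff_cancel_left' add_diff_eq diff_add_eq diff_eq_eq)
  moreover have "u - s \<in> S" "t - v \<in> T" using assms u by (auto intro: add_subgroup_diff)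
  ultimately have "u - s \<in> S \<inter> T" by simp
  then show "u = s" using assms(3) unfolding direct_sum_def by simp
qed

lemma proj_along_add:
  assumes "add_subgroup S" "add_subgroup T" "direct_sum S T"
  shows "proj_along S T r \<in> S"
    and "proj_along S T (r + r') = proj_along S T r + proj_along S T r'"
proof -
  have dec: "\<exists>s\<in>S. \<exists>t\<in>T. x = s + t" for x
    using assms(3) unfolding direct_sum_def by (metis UNIV_I set_plus_elim)
  obtain s t where st: "s \<in> S" "t \<in> T" "r = s + t" using dec by blast
  obtain s' t' where st': "s' \<in> S" "t' \<in> T" "r' = s' + t'" using dec by blast
  show "proj_along S T r \<in> S" using proj_along_eq[OF assms st(1,2)] st by simp
  have "r + r' = (s + s') + (t + t')" using st st' by (simp add: algebra_simps)
  moreover have "s + s' \<in> S" "t + t' \<in> T" using assms st st' unfolding add_subgroup_def by auto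
  ultimately show "proj_along S T (r + r') = proj_along S T r + proj_along S T r'"
    using proj_along_eq[OF assms] st(1,2) st'(1,2) st(3) st'(3) by metis
qed

lemma bij_betw_lmult:
  assumes "add_subgroup S" "direct_sum S (rann a)"
  shows "bij_betw (lmult a) S (rprin a)"
  unfolding bij_betw_def
proof
  show "inj_on (lmult a) S"
  proof (rule inj_onI)
    fix x y assume xy: "x \<in> S" "y \<in> S" "lmult a x = lmult a y"
    then have "x - y \<in> S \<inter> rann a"
      using assms(1) by (auto simp: rann_def lmult_def right_diff_distrib intro: add_subgroup_diff)
    then show "x = y" using assms(2) unfolding direct_sum_def by simp
  qed
  show "lmult a ` S = rprin a"
  proof (intro equalityI subsetI)
    fix x assume "x \<in> rprin a"
    then obtain r where r: "x = a * r" unfolding rprin_def by blast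
    obtain s t where "s \<in> S" "t \<in> rann a" "r = s + t"
      using assms(2) unfolding direct_sum_def by (metis UNIV_I set_plus_elim)
    then show "x \<in> lmult a ` S" using r by (auto simp: rann_def lmult_def distrib_left)
  qed (auto simp: rprin_def lmult_def)
qed

lemma psi_add:
  assumes "right_ideal S" "right_ideal T" "direct_sum S (rann a)" "direct_sum (rprin a) T"
  shows "psi a S T (r + r') = psi a S T r + psi a S T r'"
proof -
  have S: "add_subgroup S" and T: "add_subgroup T" using assms by (auto simp: right_ideal_def)
  note b = bij_betw_lmult[OF S assms(3)]
  note p = proj_along_add[OF add_subgroup_rprin T assms(4)]
  have in_S: "psi a S T x \<in> S" and img: "a * psi a S T x = proj_along (rprin a) T x" for x
    using b p(1)[of x] inv_into_into[of "proj_along (rprin a) T x" "lmult a" S]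
      f_inv_into_f[of "proj_along (rprin a) T x" "lmult a" S]
    by (auto simp: psi_def bij_betw_def lmult_def)
  have "lmult a (psi a S T (r + r')) = lmult a (psi a S T r + psi a S T r')"
    by (simp add: lmult_def distrib_left img p(2))
  moreover have "psi a S T r + psi a S T r' \<in> S" using S in_S by (auto simp: add_subgroup_def)
  ultimately show ?thesis using b in_S unfolding bij_betw_def by (metis inj_onD)
qed

lemma inverse12_unique:
  assumes "is_inverse12_rprin_rann a S T b" "is_inverse12_rprin_rann a S T c"
  shows "b = c"
proof -
  note d = assms[unfolded is_inverse12_rprin_rann_def]
  have "b * 1 \<in> rprin c" using d unfolding rprin_def by blast
  then obtain x where x: "b = c * x" unfolding rprin_def by auto
  have "c * a * b = (c * a * c) * x" using x by (simp add: mult.assoc)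
  then have 1: "c * a * b = b" using d x by simp
  have "b * (1 - a * b) = b - b * a * b" by (simp add: right_diff_distrib mult.assoc)
  then have "b * (1 - a * b) = 0" using d by simp
  then have "1 - a * b \<in> rann b" unfolding rann_def by simp
  then have "c * (1 - a * b) = 0" using d unfolding rann_def by blast
  then have "c = c * a * b" by (simp add: right_diff_distrib mult.assoc)
  then show ?thesis using 1 by simp
qed

end

theory Submission imports Defs begin

text \<open>The element \<open>psi a S T r\<close> is the only \<open>s \<in> S\<close> for which \<open>a * s\<close> is the component of \<open>r\<close>
  in \<open>rprin a\<close> (lemma \<open>eq_psi_iff\<close>). Because \<open>S\<close>, \<open>rprin a\<close> and \<open>T\<close> are right ideals, both the
  projection and \<open>psi a S T\<close> commute with right multiplication, so \<open>psi a S T\<close> is left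
  multiplication by its value at \<open>1\<close> (lemma \<open>psi_eq_lmult\<close>). Each of the three assertions
  therefore says \<open>b = psi a S T 1\<close>: the first by the characterization of \<open>psi\<close>, the second by
  evaluation at \<open>1\<close>. For the third, \<open>psi a S T\<close> undoes multiplication by \<open>a\<close> on \<open>S\<close> and vanishes
  exactly on \<open>T\<close>, which makes \<open>psi a S T 1\<close> an inverse with the prescribed range and annihilator
  (lemma \<open>is_inverse12_psi_one\<close>), and such an inverse is unique.\<close>

lemma right_ideal_rprin: "right_ideal (rprin a)"
  unfolding right_ideal_def using add_subgroup_rprin[of a]
  by (auto simp: rprin_def mult.assoc)

lemma direct_sum_decompose:
  assumes "direct_sum S T"
  obtains s t where "s \<in> S" "t \<in> T" "r = s + t"
  using assms unfolding direct_sum_def by (metis UNIV_I set_plus_elim)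

lemma proj_along_eq_self:
  assumes "add_subgroup S" "add_subgroup T" "direct_sum S T" "s \<in> S"
  shows "proj_along S T s = s"
  using proj_along_eq[OF assms, of 0] assms(2) by (simp add: add_subgroup_def)

lemma proj_along_eq_0_iff:
  assumes "add_subgroup S" "add_subgroup T" "direct_sum S T"
  shows "proj_along S T r = 0 \<longleftrightarrow> r \<in> T"
proof -
  obtain s t where st: "s \<in> S" "t \<in> T" "r = s + t"
    using direct_sum_decompose[OF assms(3)] .
  have "0 \<in> S" using assms(1) by (simp add: add_subgroup_def)
  then have "r \<in> T \<Longrightarrow> proj_along S T r = 0"
    using proj_along_eq[OF assms, of 0 r] by simp
  moreover have "proj_along S T r = s" using proj_along_eq[OF assms st(1,2)] st(3) by simp
  ultimately show ?thesis using st by auto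
qed

text \<open>Multiplying a decomposition \<open>x = s + t\<close> by \<open>r\<close> on the right gives the decomposition of
  \<open>x * r\<close>, since the summands absorb right factors.\<close>

lemma proj_along_mult_right:
  assumes "right_ideal S" "right_ideal T" "direct_sum S T"
  shows "proj_along S T (x * r) = proj_along S T x * r"
proof -
  have sub: "add_subgroup S" "add_subgroup T" using assms by (auto simp: right_ideal_def)
  obtain s t where st: "s \<in> S" "t \<in> T" "x = s + t"
    using direct_sum_decompose[OF assms(3)] .
  have "s * r \<in> S" "t * r \<in> T" using assms st by (auto simp: right_ideal_def)
  then have "proj_along S T (s * r + t * r) = s * r"
    by (rule proj_along_eq[OF sub assms(3)])
  then show ?thesis using proj_along_eq[OF sub assms(3) st(1,2)] st(3)
    by (simp add: distrib_right)
qed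

text \<open>This replaces the inverse function in the definition of \<open>psi\<close> by an equation in the ring,
  which is how \<open>psi\<close> is used from here on.\<close>

lemma eq_psi_iff:
  assumes "add_subgroup S" "add_subgroup T" "direct_sum S (rann a)" "direct_sum (rprin a) T"
  shows "s = psi a S T r \<longleftrightarrow> s \<in> S \<and> a * s = proj_along (rprin a) T r"
proof -
  note bij = bij_betw_lmult[OF assms(1,3)]
  have "proj_along (rprin a) T r \<in> lmult a ` S"
    using bij proj_along_add(1)[OF add_subgroup_rprin assms(2,4)] by (simp add: bij_betw_def)
  then have "psi a S T r \<in> S" "lmult a (psi a S T r) = proj_along (rprin a) T r"
    unfolding psi_def by (rule inv_into_into, rule f_inv_into_f)
  moreover have "s = psi a S T r" if "s \<in> S" "lmult a s = proj_along (rprin a) T r"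
    using that bij inv_into_f_f[of "lmult a" S s] by (simp add: psi_def bij_betw_def)
  ultimately show ?thesis by (auto simp: lmult_def)
qed

lemma psi_eq_lmult:
  assumes "right_ideal S" "right_ideal T" "direct_sum S (rann a)" "direct_sum (rprin a) T"
  shows "psi a S T = lmult (psi a S T 1)"
proof
  fix r
  have sub: "add_subgroup S" "add_subgroup T" using assms by (auto simp: right_ideal_def)
  note char = eq_psi_iff[OF sub assms(3,4)]
  have one: "psi a S T 1 \<in> S" "a * psi a S T 1 = proj_along (rprin a) T 1"
    using char by blast+
  have "psi a S T 1 * r \<in> S" using one(1) assms(1) by (simp add: right_ideal_def)
  moreover have "a * (psi a S T 1 * r) = proj_along (rprin a) T r"
    using proj_along_mult_right[OF right_ideal_rprin assms(2,4), of 1 r] one(2)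
    by (simp flip: mult.assoc)
  ultimately show "psi a S T r = lmult (psi a S T 1) r"
    using char[of "psi a S T 1 * r" r] by (simp add: lmult_def)
qed

text \<open>Write \<open>c\<close> for \<open>psi a S T 1\<close>, so that \<open>psi a S T r = c * r\<close>. Elements of \<open>rprin a\<close> are
  fixed by the projection, hence \<open>c * (a * s) = s\<close> on \<open>S\<close>; this gives \<open>c * a * c = c\<close> at
  \<open>s = c\<close> and places \<open>S\<close> inside \<open>rprin c\<close>. The annihilator is \<open>T\<close> because \<open>c * r\<close> vanishes
  exactly when the projection of \<open>r\<close> does.\<close>

lemma is_inverse12_psi_one:
  assumes "right_ideal S" "right_ideal T" "direct_sum S (rann a)" "direct_sum (rprin a) T"
  shows "is_inverse12_rprin_rann a S T (psi a S T 1)"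
proof -
  define c where "c = psi a S T 1"
  have sub: "add_subgroup S" "add_subgroup T" using assms by (auto simp: right_ideal_def)
  note char = eq_psi_iff[OF sub assms(3,4)]
  note sum = add_subgroup_rprin[of a] sub(2) assms(4)
  have psi_c: "psi a S T r = c * r" for r
    using psi_eq_lmult[OF assms] by (metis c_def lmult_def)
  have c_S: "c * r \<in> S" and a_c: "a * (c * r) = proj_along (rprin a) T r" for r
    using char[of "c * r" r] psi_c by simp_all
  have proj_a: "proj_along (rprin a) T (a * r) = a * r" for r
    by (rule proj_along_eq_self[OF sum]) (auto simp: rprin_def)
  have c_a: "c * (a * s) = s" if "s \<in> S" for s
    using char[of s "a * s"] that proj_a psi_c by simp
  have "a * c * a = a" using a_c[of a] proj_a[of 1] by (simp add: mult.assoc)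
  moreover have "c * a * c = c" using c_a[of c] c_S[of 1] by (simp add: mult.assoc)
  moreover have "rprin c = S"
    unfolding rprin_def using c_S c_a by (auto, metis)
  moreover have "rann c = T"
  proof -
    have "c * r = 0 \<longleftrightarrow> proj_along (rprin a) T r = 0" for r
      using char[of 0 r] psi_c[of r] sub(1) by (auto simp: add_subgroup_def)
    then show ?thesis
      unfolding rann_def using proj_along_eq_0_iff[OF sum] by auto
  qed
  ultimately show ?thesis by (simp add: is_inverse12_rprin_rann_def c_def)
qed

theorem theorem6p9:
  fixes a b :: "'a::ring_1" and S T :: "'a set"
  assumes "right_ideal S" and "right_ideal T"
    and "direct_sum S (rann a)"
    and "direct_sum (rprin a) T"
  shows "((b \<in> S \<and> a * b = proj_along (rprin a) T 1 \<and>
            (\<forall>x\<in>S. a * x = proj_along (rprin a) T 1 \<longrightarrow> x = b))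
          \<longleftrightarrow> psi a S T = lmult b)
       \<and> (psi a S T = lmult b \<longleftrightarrow> is_inverse12_rprin_rann a S T b)"
proof -
  have sub: "add_subgroup S" "add_subgroup T" using assms by (auto simp: right_ideal_def)
  note char = eq_psi_iff[OF sub assms(3,4), where r = 1]
  have 1: "(b \<in> S \<and> a * b = proj_along (rprin a) T 1 \<and>
            (\<forall>x\<in>S. a * x = proj_along (rprin a) T 1 \<longrightarrow> x = b)) \<longleftrightarrow> b = psi a S T 1"
    using char by metis
  have 2: "psi a S T = lmult b \<longleftrightarrow> b = psi a S T 1"
    using psi_eq_lmult[OF assms] by (metis lmult_def mult_1_right)
  have 3: "is_inverse12_rprin_rann a S T b \<longleftrightarrow> b = psi a S T 1"
    using is_inverse12_psi_one[OF assms] inverse12_unique by blast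
  show ?thesis using 1 2 3 by simp
qed

end
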